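(* Assume $\mathcal{S}$ and $\mathcal{A}$ are finite, and that the transition probability $P:\mathcal{S}\times\mathcal{A}\to\mathcal{P}(\mathcal{S})$ and the deterministic reward function $r:\mathcal{S}\times\mathcal{A}\to\mathbb{R}$ depend neither on the state distribution nor on the action distribution. Then the IQ function $Q_{\rm mfc}$ of the mean-field control problem is the integral of the classical single-agent Q function $Q_{\rm single}$: for all $\mu\in\mathcal{P}(\mathcal{S})$ and $h\in\mathcal{H}$, $$Q_{\rm mfc}(\mu,h)=\sum_{s\in\mathcal{S}}\mu(s)\sum_{a\in\mathcal{A}}Q_{\rm single}(s,a)\,h(s)(a).$$
   Context: $\mathcal{P}(X)$ is the set of probability measures on the finite set $X$ (the probability simplex) and $\gamma\in(0,1)$ is a discount factor. $\mathcal{H}$ is the set of maps $h:\mathcal{S}\to\mathcal{P}(\mathcal{A})$. Classical single-agent Q function: $Q_{\rm single}(s,a)=r(s,a)+\gamma\,\mathbb{E}_{s'\sim P(s,a)}[v(s')]$, where $v(s)=\sup_\pi\mathbb{E}^\pi\big[\sum_{t=0}^\infty\gamma^t r(s_t,a_t)\,\big|\,s_0=s\big]$ is the value function of the Markov decision problem with $s_{t+1}\sim P(s_t,a_t)$, $a_t\sim\pi_t(s_t)$, the supremum being over controls $\pi=\{\pi_t\}_{t\ge0}$ with $\pi_t:\mathcal{S}\to\mathcal{A}$ (deterministic) or $\pi_t:\mathcal{S}\to\mathcal{P}(\mathcal{A})$ (randomized). IQ function: $\Pi_1$ is the set of sequences $\pi=\{\pi_t\}_{t\ge1}$ of measurable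 maps $\pi_t:\mathcal{S}\times\mathcal{P}(\mathcal{S})\to\mathcal{P}(\mathcal{A})$. For $\mu\in\mathcal{P}(\mathcal{S})$ and $h\in\mathcal{H}$, $$Q_{\rm mfc}(\mu,h)=\sup_{\pi\in\Pi_1}\mathbb{E}^\pi\Big[\sum_{t=0}^\infty\gamma^t r(s_t,a_t)\,\Big|\,s_0\sim\mu,\ a_0\sim h(s_0),\ a_t\sim\pi_t(s_t,\mu_t)\text{ for }t\ge1\Big],$$ where $s_{t+1}\sim P(s_t,a_t)$ and $\mu_t$ is the law of $s_t$. *)

theory Defs
  imports "HOL-Probability.Probability"
begin

section \<open>Controlled processes\<close>

definition state_action_law :: "'s pmf \<Rightarrow> ('s \<Rightarrow> 'a pmf) \<Rightarrow> ('s \<times> 'a) pmf" where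
  "state_action_law \<mu> k = bind_pmf \<mu> (\<lambda>s. map_pmf (Pair s) (k s))"

text \<open>
  Conditional law of the pair (s_t, a_t) given the past pairs, when s_0 has law \<open>\<mu>\<close>,
  s_(t+1) is drawn from P(s_t, a_t), and a_t is drawn from \<open>d t s_t\<close>.
\<close>
definition pair_kernel ::
  "('s \<times> 'a \<Rightarrow> 's pmf) \<Rightarrow> 's pmf \<Rightarrow> (nat \<Rightarrow> 's \<Rightarrow> 'a pmf) \<Rightarrow> nat \<Rightarrow> (nat \<Rightarrow> 's \<times> 'a) \<Rightarrow> ('s \<times> 'a) pmf" where
  "pair_kernel P \<mu> d t \<omega> =
     (case t of 0 \<Rightarrow> state_action_law \<mu> (d 0)
              | Suc n \<Rightarrow> state_action_law (P (\<omega> n)) (d (Suc n)))"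

text \<open>
  The law on infinite trajectories given by the Ionescu-Tulcea construction. The constant \<open>lim\<close>
  is meaningful only once the locale assumptions hold; this is shown below.
\<close>
definition trajectory ::
  "('s \<times> 'a \<Rightarrow> 's pmf) \<Rightarrow> 's pmf \<Rightarrow> (nat \<Rightarrow> 's \<Rightarrow> 'a pmf) \<Rightarrow> (nat \<Rightarrow> 's \<times> 'a) measure" where
  "trajectory P \<mu> d =
     projective_family.lim UNIV
       (Ionescu_Tulcea.CI (\<lambda>t \<omega>. measure_pmf (pair_kernel P \<mu> d t \<omega>)) (\<lambda>_. count_space UNIV))
       (\<lambda>_. count_space UNIV)"

definition expected_return ::
  "('s \<times> 'a \<Rightarrow> 's pmf) \<Rightarrow> ('s \<times> 'a \<Rightarrow> real) \<Rightarrow> real \<Rightarrow> 's pmf \<Rightarrow> (nat \<Rightarrow> 's \<Rightarrow> 'a pmf) \<Rightarrow> real" where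
  "expected_return P r \<gamma> \<mu> d = (\<integral>\<omega>. (\<Sum>t. \<gamma> ^ t * r (\<omega> t)) \<partial>trajectory P \<mu> d)"


section \<open>The single-agent problem\<close>

definition deterministic_controls :: "(nat \<Rightarrow> 's \<Rightarrow> 'a pmf) set" where
  "deterministic_controls = {d. \<exists>f. d = (\<lambda>t s. return_pmf (f t s))}"

definition randomized_controls :: "(nat \<Rightarrow> 's \<Rightarrow> 'a pmf) set" where
  "randomized_controls = UNIV"

definition value_function ::
  "('s \<times> 'a \<Rightarrow> 's pmf) \<Rightarrow> ('s \<times> 'a \<Rightarrow> real) \<Rightarrow> real \<Rightarrow> (nat \<Rightarrow> 's \<Rightarrow> 'a pmf) set \<Rightarrow> 's \<Rightarrow> real" where
  "value_function P r \<gamma> D s = (SUP d\<in>D. expected_return P r \<gamma> (return_pmf s) d)"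

definition Q_single ::
  "('s \<times> 'a \<Rightarrow> 's pmf) \<Rightarrow> ('s \<times> 'a \<Rightarrow> real) \<Rightarrow> real \<Rightarrow> (nat \<Rightarrow> 's \<Rightarrow> 'a pmf) set \<Rightarrow> 's \<Rightarrow> 'a \<Rightarrow> real" where
  "Q_single P r \<gamma> D s a =
     r (s, a) + \<gamma> * measure_pmf.expectation (P (s, a)) (value_function P r \<gamma> D)"


section \<open>The mean-field control problem\<close>

text \<open>The Borel sets of the probability simplex, seen as a subset of Euclidean space.\<close>
definition simplex_borel :: "'x::finite pmf measure" where
  "simplex_borel = vimage_algebra UNIV (\<lambda>p. (\<chi> x. pmf p x) :: real ^ 'x) borel"

text \<open>The entry at time 0 is never used, so that only the entries from time 1 on are constrained.\<close>
definition mfc_policies :: "(nat \<Rightarrow> 's::finite \<times> 's pmf \<Rightarrow> 'a::finite pmf) set" where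
  "mfc_policies =
     {\<pi>. \<forall>t\<ge>1. \<pi> t \<in> measurable (count_space UNIV \<Otimes>\<^sub>M simplex_borel) simplex_borel}"

primrec state_law ::
  "('s \<times> 'a \<Rightarrow> 's pmf) \<Rightarrow> 's pmf \<Rightarrow> ('s \<Rightarrow> 'a pmf) \<Rightarrow> (nat \<Rightarrow> 's \<times> 's pmf \<Rightarrow> 'a pmf) \<Rightarrow> nat \<Rightarrow> 's pmf" where
  "state_law P \<mu> h \<pi> 0 = \<mu>"
| "state_law P \<mu> h \<pi> (Suc t) =
     bind_pmf
       (state_action_law (state_law P \<mu> h \<pi> t)
          (if t = 0 then h else (\<lambda>s. \<pi> t (s, state_law P \<mu> h \<pi> t)))) P"

definition mfc_control ::
  "('s \<times> 'a \<Rightarrow> 's pmf) \<Rightarrow> 's pmf \<Rightarrow> ('s \<Rightarrow> 'a pmf) \<Rightarrow> (nat \<Rightarrow> 's \<times> 's pmf \<Rightarrow> 'a pmf) \<Rightarrow> nat \<Rightarrow> 's \<Rightarrow> 'a pmf" where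
  "mfc_control P \<mu> h \<pi> t = (if t = 0 then h else (\<lambda>s. \<pi> t (s, state_law P \<mu> h \<pi> t)))"

definition Q_mfc ::
  "('s::finite \<times> 'a::finite \<Rightarrow> 's pmf) \<Rightarrow> ('s \<times> 'a \<Rightarrow> real) \<Rightarrow> real \<Rightarrow> 's pmf \<Rightarrow> ('s \<Rightarrow> 'a pmf) \<Rightarrow> real" where
  "Q_mfc P r \<gamma> \<mu> h =
     (SUP \<pi>\<in>mfc_policies. expected_return P r \<gamma> \<mu> (mfc_control P \<mu> h \<pi>))"


section \<open>Well-definedness\<close>

lemma measurable_simplex_borel_iff:
  "f \<in> measurable M (simplex_borel :: 'x::finite pmf measure) \<longleftrightarrow>
     (\<forall>x. (\<lambda>y. pmf (f y) x) \<in> borel_measurable M)"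
proof -
  let ?e = "\<lambda>p. (\<chi> x. pmf p x) :: real ^ 'x"
  have "f \<in> measurable M (simplex_borel :: 'x pmf measure) \<longleftrightarrow> (\<lambda>y. ?e (f y)) \<in> borel_measurable M"
  proof
    assume "f \<in> measurable M (simplex_borel :: 'x pmf measure)"
    then show "(\<lambda>y. ?e (f y)) \<in> borel_measurable M"
      unfolding simplex_borel_def
      by (rule measurable_compose[OF _ measurable_vimage_algebra1]) simp
  next
    assume "(\<lambda>y. ?e (f y)) \<in> borel_measurable M"
    then show "f \<in> measurable M (simplex_borel :: 'x pmf measure)"
      unfolding simplex_borel_def by (intro measurable_vimage_algebra2) auto
  qed
  also have "\<dots> \<longleftrightarrow> (\<forall>x. (\<lambda>y. pmf (f y) x) \<in> borel_measurable M)"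
    by (subst borel_measurable_euclidean_space)
       (auto simp: Basis_vec_def cart_eq_inner_axis[symmetric] inner_axis)
  finally show ?thesis .
qed

lemma mfc_policies_nonempty: "mfc_policies \<noteq> {}"
proof -
  have "(\<lambda>_ _. undefined) \<in> mfc_policies"
    by (auto simp: mfc_policies_def measurable_simplex_borel_iff)
  then show ?thesis by blast
qed

lemma Ionescu_Tulcea_pair_kernel:
  fixes P :: "'s::finite \<times> 'a::finite \<Rightarrow> 's pmf"
  shows "Ionescu_Tulcea (\<lambda>t \<omega>. measure_pmf (pair_kernel P \<mu> d t \<omega>)) (\<lambda>_. count_space UNIV)"
proof
  fix i :: nat
  show "(\<lambda>\<omega>. measure_pmf (pair_kernel P \<mu> d i \<omega>)) \<in>
    measurable (PiM {0..<i} (\<lambda>_. count_space UNIV)) (subprob_algebra (count_space UNIV))"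
  proof (cases i)
    case 0
    then show ?thesis
      by (auto simp: pair_kernel_def space_subprob_algebra measure_pmf.subprob_space_axioms)
  next
    case (Suc n)
    have "(\<lambda>x. measure_pmf (state_action_law (P x) (d (Suc n)))) \<in>
        measurable (count_space UNIV) (subprob_algebra (count_space UNIV))"
      by (auto simp: space_subprob_algebra measure_pmf.subprob_space_axioms)
    from measurable_compose[OF _ this, of "\<lambda>\<omega>. \<omega> n" "PiM {0..<i} (\<lambda>_. count_space UNIV)"] Suc
    show ?thesis by (simp add: pair_kernel_def measurable_component_singleton)
  qed
qed

lemma prob_space_trajectory:
  fixes P :: "'s::finite \<times> 'a::finite \<Rightarrow> 's pmf"
  shows "prob_space (trajectory P \<mu> d)"
proof -
  interpret Ionescu_Tulcea "\<lambda>t \<omega>. measure_pmf (pair_kernel P \<mu> d t \<omega>)" "\<lambda>_. count_space UNIV"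
    by (rule Ionescu_Tulcea_pair_kernel)
  have "emeasure PF.lim (PF.emb UNIV {} (space (PiM {} (\<lambda>_. count_space UNIV)))) = emeasure (CI {}) (space (PiM {} (\<lambda>_. count_space UNIV)))"
    by (rule lim) auto
  moreover have "emeasure (CI {}) (space (PiM {} (\<lambda>_. count_space UNIV))) = 1"
    using prob_space.emeasure_space_1[OF PF.prob_space_P[of "{}"]]
    by (simp add: PF.space_P)
  moreover have "PF.emb UNIV {} (space (PiM {} (\<lambda>_. count_space UNIV))) = space PF.lim"
    by (auto simp: prod_emb_def PF.space_lim space_PiM)
  ultimately show ?thesis
    unfolding trajectory_def by (intro prob_spaceI) simp
qed

lemma sets_trajectory [measurable_cong]:
  fixes P :: "'s::finite \<times> 'a::finite \<Rightarrow> 's pmf"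
  shows "sets (trajectory P \<mu> d) = sets (PiM UNIV (\<lambda>_. count_space UNIV))"
proof -
  interpret Ionescu_Tulcea "\<lambda>t \<omega>. measure_pmf (pair_kernel P \<mu> d t \<omega>)" "\<lambda>_. count_space UNIV"
    by (rule Ionescu_Tulcea_pair_kernel)
  show ?thesis unfolding trajectory_def by (rule PF.sets_lim)
qed

text \<open>The laws along a trajectory are the expected ones; in particular \<open>state_law\<close> is the law of s_t.\<close>

lemma (in Ionescu_Tulcea) distr_C_Suc_last:
  "distr (C 0 (Suc n) (\<lambda>_. undefined)) (M n) (\<lambda>\<omega>. \<omega> n) = C 0 n (\<lambda>_. undefined) \<bind> P n"
proof -
  have u: "(\<lambda>_. undefined) \<in> space (PiM {0..<0} M)" by (simp add: space_PiM)
  have sp: "space (C 0 n (\<lambda>_. undefined)) = space (PiM {0..<n} M)"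
    using space_C[OF u, of n] by simp
  have s: "sets (C 0 n (\<lambda>_. undefined)) = sets (PiM {0..<n} M)"
    using sets_C[OF u, of n] by simp
  have ne: "space (C 0 n (\<lambda>_. undefined)) \<noteq> {}"
    using prob_space.not_empty[OF prob_space_C[OF u]] .
  have "distr (C 0 (Suc n) (\<lambda>_. undefined)) (M n) (\<lambda>\<omega>. \<omega> n) =
      C 0 n (\<lambda>_. undefined) \<bind> (\<lambda>x. distr (eP n x) (M n) (\<lambda>\<omega>. \<omega> n))"
    unfolding C.simps add_0
    by (rule distr_bind[where K="PiM {0..<Suc n} M"])
       (use ne in \<open>auto simp: measurable_cong_sets[OF s refl] intro!: measurable_component_singleton\<close>)
  also have "\<dots> = C 0 n (\<lambda>_. undefined) \<bind> P n"
  proof (rule bind_cong[OF refl])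
    fix x assume "x \<in> space (C 0 n (\<lambda>_. undefined))"
    then have x: "x \<in> space (PiM {0..<n} M)" by (simp add: sp)
    have m: "fun_upd x n \<in> measurable (P n x) (PiM {0..<Suc n} M)"
      using x by (intro measurable_fun_upd[where J="{0..<n}"]) (auto simp: measurable_cong_sets[OF sets_P[OF x] refl])
    have "distr (eP n x) (M n) (\<lambda>\<omega>. \<omega> n) = distr (P n x) (M n) ((\<lambda>\<omega>. \<omega> n) \<circ> fun_upd x n)"
      unfolding eP_def by (rule distr_distr[OF measurable_component_singleton m]) simp
    also have "\<dots> = P n x"
      by (simp add: comp_def distr_id2 sets_P[OF x])
    finally show "distr (eP n x) (M n) (\<lambda>\<omega>. \<omega> n) = P n x" .
  qed
  finally show ?thesis .
qed

lemma (in Ionescu_Tulcea) distr_lim_component: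
  "distr PF.lim (M n) (\<lambda>\<omega>. \<omega> n) = C 0 n (\<lambda>_. undefined) \<bind> P n"
proof -
  have up: "up_to {0..<Suc n} = Suc n"
    using up_to_less[of "{0..<Suc n}" n] by (intro antisym) (auto simp: up_to_iff)
  have u: "(\<lambda>_. undefined) \<in> space (PiM {0..<0} M)" by (simp add: space_PiM)
  have c: "C 0 (Suc n) (\<lambda>_. undefined) = CI {0..<Suc n}"
    using distr_C[of "Suc n" "Suc n" "\<lambda>_. undefined" 0] u by (simp add: CI_def up del: C.simps)
  have "distr PF.lim (M n) (\<lambda>\<omega>. \<omega> n) =
      distr PF.lim (M n) ((\<lambda>\<omega>. \<omega> n) \<circ> (\<lambda>\<omega>. restrict \<omega> {0..<Suc n}))"
    by (simp add: comp_def)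
  also have "\<dots> = distr (distr PF.lim (PiM {0..<Suc n} M) (\<lambda>\<omega>. restrict \<omega> {0..<Suc n})) (M n) (\<lambda>\<omega>. \<omega> n)"
    by (intro distr_distr[symmetric])
       (auto simp: measurable_cong_sets[OF PF.sets_lim refl]
             intro!: measurable_component_singleton measurable_restrict)
  also have "\<dots> = C 0 n (\<lambda>_. undefined) \<bind> P n"
    by (subst distr_lim) (simp_all add: c[symmetric] distr_C_Suc_last del: C.simps)
  finally show ?thesis .
qed

lemma distr_trajectory_0:
  fixes P :: "'s::finite \<times> 'a::finite \<Rightarrow> 's pmf"
  shows "distr (trajectory P \<mu> d) (count_space UNIV) (\<lambda>\<omega>. \<omega> 0) = measure_pmf (state_action_law \<mu> (d 0))"
proof -
  interpret Ionescu_Tulcea "\<lambda>t \<omega>. measure_pmf (pair_kernel P \<mu> d t \<omega>)" "\<lambda>_. count_space UNIV"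
    by (rule Ionescu_Tulcea_pair_kernel)
  have "distr (trajectory P \<mu> d) (count_space UNIV) (\<lambda>\<omega>. \<omega> 0) =
      return (PiM {0..<0} (\<lambda>_. count_space UNIV)) (\<lambda>_. undefined) \<bind> (\<lambda>\<omega>. measure_pmf (pair_kernel P \<mu> d 0 \<omega>))"
    unfolding trajectory_def using distr_lim_component[of 0] by simp
  also have "\<dots> = measure_pmf (pair_kernel P \<mu> d 0 (\<lambda>_. undefined))"
    by (rule bind_return[OF P]) (simp add: space_PiM)
  finally show ?thesis by (simp add: pair_kernel_def)
qed

lemma distr_trajectory_Suc:
  fixes P :: "'s::finite \<times> 'a::finite \<Rightarrow> 's pmf"
  assumes "distr (trajectory P \<mu> d) (count_space UNIV) (\<lambda>\<omega>. \<omega> n) = measure_pmf p"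
  shows "distr (trajectory P \<mu> d) (count_space UNIV) (\<lambda>\<omega>. \<omega> (Suc n)) =
    measure_pmf (state_action_law (bind_pmf p P) (d (Suc n)))"
proof -
  interpret Ionescu_Tulcea "\<lambda>t \<omega>. measure_pmf (pair_kernel P \<mu> d t \<omega>)" "\<lambda>_. count_space UNIV"
    by (rule Ionescu_Tulcea_pair_kernel)
  let ?C = "C 0 (Suc n) (\<lambda>_. undefined)"
  let ?k = "\<lambda>x. measure_pmf (state_action_law (P x) (d (Suc n)))"
  have u: "(\<lambda>_. undefined) \<in> space (PiM {0..<0::nat} (\<lambda>_. count_space UNIV))" by (simp add: space_PiM)
  have s: "sets ?C = sets (PiM {0..<Suc n} (\<lambda>_. count_space UNIV))"
    using sets_C[OF u, of "Suc n"] by simp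
  have ne: "space ?C \<noteq> {}"
    using prob_space.not_empty[OF prob_space_C[OF u]] .
  have m: "(\<lambda>\<omega>. \<omega> n) \<in> measurable ?C (count_space UNIV)"
    unfolding measurable_cong_sets[OF s refl]
    by (rule measurable_component_singleton[where M="\<lambda>_. count_space UNIV"]) simp
  have k: "?k \<in> measurable (count_space UNIV) (subprob_algebra (count_space UNIV))"
    by (auto simp: space_subprob_algebra measure_pmf.subprob_space_axioms)
  have "distr (trajectory P \<mu> d) (count_space UNIV) (\<lambda>\<omega>. \<omega> (Suc n)) = ?C \<bind> (\<lambda>\<omega>. ?k (\<omega> n))"
    unfolding trajectory_def using distr_lim_component[of "Suc n"] by (simp add: pair_kernel_def del: C.simps)
  also have "\<dots> = distr ?C (count_space UNIV) (\<lambda>\<omega>. \<omega> n) \<bind> ?k"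
    by (rule bind_distr[OF m k ne, symmetric])
  also have "distr ?C (count_space UNIV) (\<lambda>\<omega>. \<omega> n) = measure_pmf p"
    using assms distr_C_Suc_last[of n] distr_lim_component[of n] by (simp add: trajectory_def del: C.simps)
  also have "measure_pmf p \<bind> ?k = measure_pmf (state_action_law (bind_pmf p P) (d (Suc n)))"
    by (simp add: measure_pmf_bind[symmetric] state_action_law_def bind_assoc_pmf)
  finally show ?thesis .
qed

lemma distr_trajectory_mfc_control:
  fixes P :: "'s::finite \<times> 'a::finite \<Rightarrow> 's pmf"
  shows "distr (trajectory P \<mu> (mfc_control P \<mu> h \<pi>)) (count_space UNIV) (\<lambda>\<omega>. \<omega> t) =
    measure_pmf (state_action_law (state_law P \<mu> h \<pi> t) (mfc_control P \<mu> h \<pi> t))"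
proof (induction t)
  case 0
  then show ?case by (simp add: distr_trajectory_0)
next
  case (Suc t)
  from distr_trajectory_Suc[OF Suc] show ?case by (simp add: mfc_control_def)
qed

corollary distr_trajectory_state:
  fixes P :: "'s::finite \<times> 'a::finite \<Rightarrow> 's pmf"
  shows "distr (trajectory P \<mu> (mfc_control P \<mu> h \<pi>)) (count_space UNIV) (\<lambda>\<omega>. fst (\<omega> t)) =
    measure_pmf (state_law P \<mu> h \<pi> t)"
proof -
  let ?T = "trajectory P \<mu> (mfc_control P \<mu> h \<pi>)"
  have m: "(\<lambda>\<omega>. \<omega> t) \<in> measurable ?T (count_space UNIV)"
    unfolding measurable_cong_sets[OF sets_trajectory refl]
    by (rule measurable_component_singleton[where M="\<lambda>_. count_space UNIV"]) simp
  have "distr ?T (count_space UNIV) (\<lambda>\<omega>. fst (\<omega> t)) =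
      distr (distr ?T (count_space UNIV) (\<lambda>\<omega>. \<omega> t)) (count_space UNIV) fst"
    by (subst distr_distr[OF _ m]) (auto simp: comp_def)
  also have "\<dots> = measure_pmf (map_pmf fst (state_action_law (state_law P \<mu> h \<pi> t) (mfc_control P \<mu> h \<pi> t)))"
    by (simp add: distr_trajectory_mfc_control map_pmf_rep_eq)
  also have "\<dots> = measure_pmf (state_law P \<mu> h \<pi> t)"
    by (simp add: state_action_law_def map_bind_pmf pmf.map_comp comp_def map_pmf_const bind_return_pmf')
  finally show ?thesis .
qed

lemma bdd_above_expected_return:
  fixes P :: "'s::finite \<times> 'a::finite \<Rightarrow> 's pmf"
  assumes "0 < \<gamma>" "\<gamma> < 1"
  shows "bdd_above ((\<lambda>d. expected_return P r \<gamma> \<mu> d) ` D)"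
proof -
  define B where "B = Max (range (\<lambda>x. \<bar>r x\<bar>))"
  have B: "\<bar>r x\<bar> \<le> B" for x unfolding B_def by (rule Max_ge) auto
  have g: "summable (\<lambda>t. \<gamma> ^ t * B)"
    using assms by (intro summable_mult2 summable_geometric) auto
  have bd: "\<bar>\<gamma> ^ t * r x\<bar> \<le> \<gamma> ^ t * B" for t x
    using assms B[of x] by (simp add: abs_mult mult_left_mono)
  have sm: "summable (\<lambda>t. \<gamma> ^ t * r (\<omega> t))" for \<omega> :: "nat \<Rightarrow> 's \<times> 'a"
    using bd by (intro summable_comparison_test[OF _ g]) auto
  have le: "(\<Sum>t. \<gamma> ^ t * r (\<omega> t)) \<le> (\<Sum>t. \<gamma> ^ t * B)" for \<omega> :: "nat \<Rightarrow> 's \<times> 'a"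
    using bd abs_le_D1 by (intro suminf_le sm g) blast
  have nn: "0 \<le> (\<Sum>t. \<gamma> ^ t * B)"
    using bd abs_ge_zero order_trans by (intro suminf_nonneg g) blast
  have "expected_return P r \<gamma> \<mu> d \<le> (\<Sum>t. \<gamma> ^ t * B)" for d
  proof -
    interpret prob_space "trajectory P \<mu> d" by (rule prob_space_trajectory)
    show ?thesis
    proof (cases "integrable (trajectory P \<mu> d) (\<lambda>\<omega>. \<Sum>t. \<gamma> ^ t * r (\<omega> t))")
      case True
      then show ?thesis
        unfolding expected_return_def by (intro integral_le_const) (auto simp: le)
    next
      case False
      then show ?thesis
        unfolding expected_return_def using nn by (simp add: not_integrable_integral_eq)
    qed
  qed
  then show ?thesis by (auto intro!: bdd_aboveI)
qed

end

theory Submission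
  imports Defs
begin

text \<open>
  Without interaction through the state or action distribution, the mean-field problem is an
  average of single-agent problems, and the only obstacle to exchanging that average with the
  supremum is that one control has to serve all initial states at once. A stationary deterministic
  control \<open>f\<close> that is optimal from every state removes it (\<open>ex_optimal_stationary\<close>).

  By Fubini the expected return is the discounted sum of the expected rewards
  (\<open>expected_return_eq_suminf\<close>), so it depends on the control only through the one-time laws of
  the pairs \<open>(s_t, a_t)\<close>. These laws are affine in the initial law and compatible with shifting
  time, which yields the one-step equation \<open>expected_return_step\<close>: the return from \<open>\<mu>\<close> is the mean,
  over \<open>s \<sim> \<mu>\<close> and \<open>a \<sim> d 0 s\<close>, of \<open>r (s, a)\<close> plus \<open>\<gamma>\<close> times the mean return of the shifted control
  from \<open>P (s, a)\<close>.

  For the existence of \<open>f\<close> no fixed point of the Bellman operator has to be constructed. There are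
  finitely many maps from states to actions; take one whose returns have the largest sum over all
  initial states. If its return violated the Bellman inequality at some state and action, switching
  to that action at that state would raise the sum (\<open>subsolution_le_expected_return\<close>). So the
  Bellman inequality holds, and it bounds the return of every control
  (\<open>expected_return_le_supersolution\<close>).

  Both kinds of single-agent controls contain \<open>f\<close>, hence have its return as value function. A
  mean-field policy induces an ordinary randomized control, since the laws \<open>\<mu>_t\<close> are deterministic;
  by the one-step equation its return is at most the average of the Q function, with equality for
  the policy that follows \<open>f\<close> from time 1 on.
\<close>

section \<open>Expected return as a discounted sum\<close>

primrec pair_law ::
  "('s \<times> 'a \<Rightarrow> 's pmf) \<Rightarrow> 's pmf \<Rightarrow> (nat \<Rightarrow> 's \<Rightarrow> 'a pmf) \<Rightarrow> nat \<Rightarrow> ('s \<times> 'a) pmf" where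
  "pair_law P \<mu> d 0 = state_action_law \<mu> (d 0)"
| "pair_law P \<mu> d (Suc t) = state_action_law (bind_pmf (pair_law P \<mu> d t) P) (d (Suc t))"

lemma distr_trajectory_pair_law:
  fixes P :: "'s::finite \<times> 'a::finite \<Rightarrow> 's pmf"
  shows "distr (trajectory P \<mu> d) (count_space UNIV) (\<lambda>\<omega>. \<omega> t) = measure_pmf (pair_law P \<mu> d t)"
  by (induction t) (simp_all add: distr_trajectory_0 distr_trajectory_Suc)

text \<open>
  The recursion of \<^const>\<open>pair_law\<close> peels off the last step, whereas dynamic programming
  conditions on the first one.
\<close>
lemma pair_law_Suc_shift:
  "pair_law P \<mu> d (Suc t) =
     pair_law P (bind_pmf (state_action_law \<mu> (d 0)) P) (\<lambda>t. d (Suc t)) t"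
  by (induction t) simp_all

lemma pair_law_mixture:
  "pair_law P \<mu> d t = bind_pmf \<mu> (\<lambda>s. pair_law P (return_pmf s) d t)"
  by (induction t)
     (simp_all add: state_action_law_def bind_assoc_pmf bind_return_pmf)

lemma expectation_bind_pmf_finite:
  fixes f :: "'b::finite \<Rightarrow> real" and p :: "'c::finite pmf"
  shows "measure_pmf.expectation (bind_pmf p k) f =
    measure_pmf.expectation p (\<lambda>x. measure_pmf.expectation (k x) f)"
  by (subst pmf_expectation_bind[of UNIV]) (simp_all add: integral_measure_pmf[of UNIV])

lemma expectation_state_action_law:
  fixes f :: "'s::finite \<times> 'a::finite \<Rightarrow> real"
  shows "measure_pmf.expectation (state_action_law \<mu> k) f =
    measure_pmf.expectation \<mu> (\<lambda>s. measure_pmf.expectation (k s) (\<lambda>a. f (s, a)))"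
  unfolding state_action_law_def by (simp add: expectation_bind_pmf_finite)

lemma expected_reward_bounded:
  fixes r :: "'x::finite \<Rightarrow> real"
  shows "\<bar>measure_pmf.expectation p r\<bar> \<le> (\<Sum>x\<in>UNIV. \<bar>r x\<bar>)"
proof -
  have "\<bar>measure_pmf.expectation p r\<bar> \<le> (\<Sum>x\<in>UNIV. \<bar>r x * pmf p x\<bar>)"
    by (simp add: integral_measure_pmf_real[of UNIV] sum_abs)
  also have "\<dots> \<le> (\<Sum>x\<in>UNIV. \<bar>r x\<bar>)"
    by (intro sum_mono) (simp add: abs_mult mult_left_le pmf_le_1)
  finally show ?thesis .
qed

lemma summable_discounted:
  fixes r :: "'x::finite \<Rightarrow> real"
  assumes "0 < \<gamma>" "\<gamma> < 1"
  shows "summable (\<lambda>t. \<gamma> ^ t * measure_pmf.expectation (p t) r)"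
proof (rule summable_comparison_test)
  show "\<exists>N. \<forall>n\<ge>N. norm (\<gamma> ^ n * measure_pmf.expectation (p n) r) \<le> \<gamma> ^ n * (\<Sum>x\<in>UNIV. \<bar>r x\<bar>)"
    using assms expected_reward_bounded[of _ r] by (simp add: abs_mult mult_left_mono)
  show "summable (\<lambda>n. \<gamma> ^ n * (\<Sum>x\<in>UNIV. \<bar>r x\<bar>))"
    using assms by (intro summable_mult2 summable_geometric) auto
qed

text \<open>
  The rewards are bounded, so the geometric weights dominate the series and permit integration
  term by term.
\<close>
lemma expected_return_eq_suminf:
  fixes P :: "'s::finite \<times> 'a::finite \<Rightarrow> 's pmf"
  assumes \<gamma>: "0 < \<gamma>" "\<gamma> < 1"
  shows "expected_return P r \<gamma> \<mu> d = (\<Sum>t. \<gamma> ^ t * measure_pmf.expectation (pair_law P \<mu> d t) r)"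
proof -
  let ?T = "trajectory P \<mu> d"
  interpret prob_space ?T by (rule prob_space_trajectory)
  have m: "(\<lambda>\<omega>. \<omega> t) \<in> measurable ?T (count_space UNIV)" for t
    unfolding measurable_cong_sets[OF sets_trajectory refl]
    by (rule measurable_component_singleton[where M="\<lambda>_. count_space UNIV"]) simp
  have E: "(\<integral>\<omega>. f (\<omega> t) \<partial>?T) = measure_pmf.expectation (pair_law P \<mu> d t) f"
    for t and f :: "'s \<times> 'a \<Rightarrow> real"
    using integral_distr[OF m, of f t] by (simp add: distr_trajectory_pair_law)
  have I: "integrable ?T (\<lambda>\<omega>. f (\<omega> t))" for t and f :: "'s \<times> 'a \<Rightarrow> real"
    using integrable_distr[OF m, of t f]
    by (simp add: distr_trajectory_pair_law integrable_measure_pmf_finite)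
  have "(\<integral>\<omega>. (\<Sum>t. \<gamma> ^ t * r (\<omega> t)) \<partial>?T) = (\<Sum>t. \<integral>\<omega>. \<gamma> ^ t * r (\<omega> t) \<partial>?T)"
  proof (rule integral_suminf)
    show "integrable ?T (\<lambda>\<omega>. \<gamma> ^ t * r (\<omega> t))" for t by (intro integrable_mult_right I)
    have "norm (\<gamma> ^ t * r x) \<le> \<gamma> ^ t * (\<Sum>x\<in>UNIV. \<bar>r x\<bar>)" for t x
      using \<gamma> by (auto simp: abs_mult intro!: mult_left_mono member_le_sum[of x UNIV "\<lambda>x. \<bar>r x\<bar>"])
    moreover have "summable (\<lambda>t. \<gamma> ^ t * (\<Sum>x\<in>UNIV. \<bar>r x\<bar>))"
      using \<gamma> by (intro summable_mult2 summable_geometric) auto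
    ultimately show "AE \<omega> in ?T. summable (\<lambda>t. norm (\<gamma> ^ t * r (\<omega> t)))"
      by (intro AE_I2, elim summable_comparison_test[rotated]) auto
    show "summable (\<lambda>t. \<integral>\<omega>. norm (\<gamma> ^ t * r (\<omega> t)) \<partial>?T)"
      using E[of "\<lambda>x. \<bar>r x\<bar>"] summable_discounted[OF \<gamma>, of "pair_law P \<mu> d" "\<lambda>x. \<bar>r x\<bar>"] \<gamma>
      by (simp add: abs_mult)
  qed
  then show ?thesis by (simp add: expected_return_def E)
qed

lemma expected_return_mixture:
  fixes P :: "'s::finite \<times> 'a::finite \<Rightarrow> 's pmf"
  assumes \<gamma>: "0 < \<gamma>" "\<gamma> < 1"
  shows "expected_return P r \<gamma> \<mu> d =
    measure_pmf.expectation \<mu> (\<lambda>s. expected_return P r \<gamma> (return_pmf s) d)"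
proof -
  let ?e = "\<lambda>s t. \<gamma> ^ t * measure_pmf.expectation (pair_law P (return_pmf s) d t) r"
  have "expected_return P r \<gamma> \<mu> d = (\<Sum>t. \<Sum>s\<in>UNIV. pmf \<mu> s * ?e s t)"
    unfolding expected_return_eq_suminf[OF \<gamma>]
    by (subst pair_law_mixture)
       (simp add: expectation_bind_pmf_finite integral_measure_pmf[of UNIV] sum_distrib_left mult_ac)
  also have "\<dots> = (\<Sum>s\<in>UNIV. \<Sum>t. pmf \<mu> s * ?e s t)"
    by (intro suminf_sum summable_mult summable_discounted \<gamma>)
  also have "\<dots> = (\<Sum>s\<in>UNIV. pmf \<mu> s * (\<Sum>t. ?e s t))"
    by (intro sum.cong refl suminf_mult summable_discounted \<gamma>)
  finally show ?thesis
    by (simp add: expected_return_eq_suminf[OF \<gamma>] integral_measure_pmf[of UNIV])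
qed


section \<open>Dynamic programming\<close>

definition action_value ::
  "('s \<times> 'a \<Rightarrow> 's pmf) \<Rightarrow> ('s \<times> 'a \<Rightarrow> real) \<Rightarrow> real \<Rightarrow> ('s \<Rightarrow> real) \<Rightarrow> 's \<times> 'a \<Rightarrow> real" where
  "action_value P r \<gamma> w x = r x + \<gamma> * measure_pmf.expectation (P x) w"

lemma expectation_mono_finite:
  fixes f g :: "'x::finite \<Rightarrow> real"
  assumes "\<And>x. f x \<le> g x"
  shows "measure_pmf.expectation p f \<le> measure_pmf.expectation p g"
  using assms by (intro integral_mono) (auto simp: integrable_measure_pmf_finite)

lemma action_value_mono:
  fixes P :: "'s::finite \<times> 'a \<Rightarrow> 's pmf"
  assumes "0 < \<gamma>" "\<And>s. v s \<le> w s"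
  shows "action_value P r \<gamma> v x \<le> action_value P r \<gamma> w x"
  unfolding action_value_def using assms by (simp add: expectation_mono_finite)

text \<open>
  With monotonicity, this is the source of the contraction: a constant gap between two value
  functions shrinks by the factor \<open>\<gamma>\<close>.
\<close>
lemma action_value_add_const:
  fixes P :: "'s::finite \<times> 'a \<Rightarrow> 's pmf"
  shows "action_value P r \<gamma> (\<lambda>s. v s + m) x = action_value P r \<gamma> v x + \<gamma> * m"
  by (simp add: action_value_def integrable_measure_pmf_finite algebra_simps)

lemma expected_return_step:
  fixes P :: "'s::finite \<times> 'a::finite \<Rightarrow> 's pmf"
  assumes \<gamma>: "0 < \<gamma>" "\<gamma> < 1"
  shows "expected_return P r \<gamma> \<mu> d =
    measure_pmf.expectation (state_action_law \<mu> (d 0))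
      (action_value P r \<gamma> (\<lambda>s. expected_return P r \<gamma> (return_pmf s) (\<lambda>t. d (Suc t))))"
proof -
  let ?p = "state_action_law \<mu> (d 0)"
  let ?q = "bind_pmf ?p P"
  let ?d = "\<lambda>t. d (Suc t)"
  let ?e = "\<lambda>t. \<gamma> ^ t * measure_pmf.expectation (pair_law P \<mu> d t) r"
  let ?e' = "\<lambda>t. \<gamma> ^ t * measure_pmf.expectation (pair_law P ?q ?d t) r"
  have "expected_return P r \<gamma> \<mu> d = (\<Sum>t. ?e (Suc t)) + ?e 0"
    unfolding expected_return_eq_suminf[OF \<gamma>]
    using suminf_split_head[OF summable_discounted[OF \<gamma>, of "pair_law P \<mu> d" r]] by linarith
  also have "(\<lambda>t. ?e (Suc t)) = (\<lambda>t. \<gamma> * ?e' t)"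
    unfolding pair_law_Suc_shift by (simp add: mult.assoc)
  also have "(\<Sum>t. \<gamma> * ?e' t) = \<gamma> * expected_return P r \<gamma> ?q ?d"
    unfolding expected_return_eq_suminf[OF \<gamma>] by (rule suminf_mult[OF summable_discounted[OF \<gamma>]])
  also have "expected_return P r \<gamma> ?q ?d =
      measure_pmf.expectation ?q (\<lambda>s. expected_return P r \<gamma> (return_pmf s) ?d)"
    by (rule expected_return_mixture[OF \<gamma>])
  finally show ?thesis
    by (simp add: action_value_def[abs_def] expectation_bind_pmf_finite integrable_measure_pmf_finite)
qed

text \<open>
  The comparison principle behind both halves of the verification argument. The infimum \<open>m\<close> of \<open>u\<close>
  is itself a lower bound, so \<open>\<gamma> * m \<le> m\<close>, which forces \<open>m \<ge> 0\<close>. The index set is arbitrary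
  because for time-dependent controls it has to contain the shifted controls as well.
\<close>
lemma discounted_nonneg:
  fixes u :: "'i \<Rightarrow> real"
  assumes "\<gamma> < 1" and bdd: "bdd_below (range u)"
    and step: "\<And>m i. (\<And>j. m \<le> u j) \<Longrightarrow> \<gamma> * m \<le> u i"
  shows "0 \<le> u i"
proof -
  let ?m = "INF i. u i"
  have "\<gamma> * ?m \<le> ?m"
    by (intro cINF_greatest step) (auto intro: cINF_lower bdd)
  then have "0 \<le> (1 - \<gamma>) * ?m" by (simp add: algebra_simps)
  then have "0 \<le> ?m" using \<open>\<gamma> < 1\<close> by (simp add: zero_le_mult_iff)
  also have "?m \<le> u i" by (rule cINF_lower[OF bdd]) simp
  finally show ?thesis .
qed

text \<open>
  The comparison principle is applied to the gap \<open>w s - J d s\<close> over all controls \<open>d\<close> and states \<open>s\<close>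
  simultaneously: one step of the dynamics replaces \<open>d\<close> by its shift, which is just another index.
\<close>
lemma expected_return_le_supersolution:
  fixes P :: "'s::finite \<times> 'a::finite \<Rightarrow> 's pmf"
  assumes \<gamma>: "0 < \<gamma>" "\<gamma> < 1"
    and w: "\<And>s a. action_value P r \<gamma> w (s, a) \<le> w s"
  shows "expected_return P r \<gamma> (return_pmf s) d \<le> w s"
proof -
  let ?J = "\<lambda>d s. expected_return P r \<gamma> (return_pmf s) d"
  let ?u = "\<lambda>(d, s). w s - ?J d s"
  have "0 \<le> ?u (d, s)"
  proof (rule discounted_nonneg[OF \<gamma>(2), where u = ?u])
    have "\<exists>b. \<forall>d. ?J d s \<le> b" for s
      using bdd_above_expected_return[OF \<gamma>, of P r "return_pmf s" UNIV] by (auto simp: bdd_above_def)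
    then obtain b where b: "\<And>d s. ?J d s \<le> b s" by metis
    have "Min (range (\<lambda>s. w s - b s)) \<le> ?u x" for x
    proof -
      obtain d s where x: "x = (d, s)" by fastforce
      have "Min (range (\<lambda>s. w s - b s)) \<le> w s - b s" by (rule Min_le) auto
      then show ?thesis using b[of s d] unfolding x prod.case by linarith
    qed
    then show "bdd_below (range ?u)" by (rule bdd_belowI2)
  next
    fix m and x :: "(nat \<Rightarrow> 's \<Rightarrow> 'a pmf) \<times> 's"
    assume m: "\<And>y. m \<le> ?u y"
    obtain d s where x: "x = (d, s)" by fastforce
    let ?d = "\<lambda>t. d (Suc t)"
    have J: "?J ?d s' \<le> w s' + (- m)" for s' using m[of "(?d, s')"] by simp
    have "action_value P r \<gamma> (?J ?d) (s, a) \<le> w s - \<gamma> * m" for a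
    proof -
      have "action_value P r \<gamma> (?J ?d) (s, a) \<le> action_value P r \<gamma> (\<lambda>s. w s + (- m)) (s, a)"
        by (rule action_value_mono[OF \<gamma>(1) J])
      then show ?thesis
        using w[of s a] unfolding action_value_add_const by linarith
    qed
    then have "measure_pmf.expectation (d 0 s) (\<lambda>a. action_value P r \<gamma> (?J ?d) (s, a)) \<le>
        measure_pmf.expectation (d 0 s) (\<lambda>a. w s - \<gamma> * m)"
      by (rule expectation_mono_finite)
    then have "?J d s \<le> w s - \<gamma> * m"
      by (subst expected_return_step[OF \<gamma>]) (simp add: expectation_state_action_law)
    then show "\<gamma> * m \<le> ?u x" by (simp add: x)
  qed
  then show ?thesis by simp
qed

definition stationary :: "('s \<Rightarrow> 'a) \<Rightarrow> nat \<Rightarrow> 's \<Rightarrow> 'a pmf" where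
  "stationary f t s = return_pmf (f s)"

lemma expected_return_stationary_step:
  fixes P :: "'s::finite \<times> 'a::finite \<Rightarrow> 's pmf"
  assumes \<gamma>: "0 < \<gamma>" "\<gamma> < 1"
  shows "expected_return P r \<gamma> (return_pmf s) (stationary f) =
    action_value P r \<gamma> (\<lambda>s. expected_return P r \<gamma> (return_pmf s) (stationary f)) (s, f s)"
  by (subst expected_return_step[OF \<gamma>])
     (simp add: expectation_state_action_law stationary_def[abs_def])

text \<open>
  Policy improvement: for \<open>w\<close> the return of an old stationary control, a control \<open>f\<close> that does not
  lose when used for one step before returning to the old one does not lose when used forever.
\<close>
lemma subsolution_le_expected_return:
  fixes P :: "'s::finite \<times> 'a::finite \<Rightarrow> 's pmf"
  assumes \<gamma>: "0 < \<gamma>" "\<gamma> < 1"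
    and w: "\<And>s. w s \<le> action_value P r \<gamma> w (s, f s)"
  shows "w s \<le> expected_return P r \<gamma> (return_pmf s) (stationary f)"
proof -
  let ?J = "\<lambda>s. expected_return P r \<gamma> (return_pmf s) (stationary f)"
  have "0 \<le> ?J s - w s"
  proof (rule discounted_nonneg[OF \<gamma>(2), where u = "\<lambda>s. ?J s - w s"])
    show "bdd_below (range (\<lambda>s. ?J s - w s))" by simp
  next
    fix m s assume "\<And>s. m \<le> ?J s - w s"
    then have "w s + m \<le> ?J s" for s by (simp add: le_diff_eq add.commute)
    then have "action_value P r \<gamma> (\<lambda>s. w s + m) (s, f s) \<le> action_value P r \<gamma> ?J (s, f s)"
      by (rule action_value_mono[OF \<gamma>(1)])
    then show "\<gamma> * m \<le> ?J s - w s"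
      using w[of s] expected_return_stationary_step[OF \<gamma>, of P r s f]
      unfolding action_value_add_const by linarith
  qed
  then show ?thesis by simp
qed

text \<open>
  Maximising the sum of the returns over the initial states, rather than the return from one state,
  makes a strict improvement at a single state contradict maximality.
\<close>
lemma ex_optimal_stationary:
  fixes P :: "'s::finite \<times> 'a::finite \<Rightarrow> 's pmf"
  assumes \<gamma>: "0 < \<gamma>" "\<gamma> < 1"
  obtains f where "\<And>d s. expected_return P r \<gamma> (return_pmf s) d
    \<le> expected_return P r \<gamma> (return_pmf s) (stationary f)"
proof -
  let ?J = "\<lambda>f s. expected_return P r \<gamma> (return_pmf s) (stationary f)"
  let ?S = "\<lambda>f. \<Sum>s\<in>UNIV. ?J f s"
  have "Max (range ?S) \<in> range ?S" by (rule Max_in) auto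
  then obtain f where f: "Max (range ?S) = ?S f" by (rule imageE)
  have max: "?S g \<le> ?S f" for g unfolding f[symmetric] by (rule Max_ge) auto
  have "action_value P r \<gamma> (?J f) (s, a) \<le> ?J f s" for s a
  proof (rule ccontr)
    assume "\<not> ?thesis"
    then have better: "?J f s < action_value P r \<gamma> (?J f) (s, a)" by simp
    let ?g = "f(s := a)"
    have "?J f s' \<le> action_value P r \<gamma> (?J f) (s', ?g s')" for s'
      using better expected_return_stationary_step[OF \<gamma>, of P r s' f] by auto
    then have le: "?J f s' \<le> ?J ?g s'" for s' by (rule subsolution_le_expected_return[OF \<gamma>])
    have "action_value P r \<gamma> (?J f) (s, a) \<le> action_value P r \<gamma> (?J ?g) (s, a)"
      by (rule action_value_mono[OF \<gamma>(1) le])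
    also have "\<dots> = ?J ?g s" using expected_return_stationary_step[OF \<gamma>, of P r s ?g] by simp
    finally have "?J f s < ?J ?g s" using better by simp
    then have "?S f < ?S ?g" using le by (intro sum_strict_mono_ex1) auto
    then show False using max[of ?g] by simp
  qed
  then show thesis by (intro that[of f] expected_return_le_supersolution[OF \<gamma>])
qed


section \<open>Exchanging the supremum and the average\<close>

theorem mainTheorem4:
  fixes P :: "'s::finite \<times> 'a::finite \<Rightarrow> 's pmf"
    and r :: "'s \<times> 'a \<Rightarrow> real"
    and \<gamma> :: real
    and D :: "(nat \<Rightarrow> 's \<Rightarrow> 'a pmf) set"
    and \<mu> :: "'s pmf"
    and h :: "'s \<Rightarrow> 'a pmf"
  assumes "0 < \<gamma>" and "\<gamma> < 1"
    and "D = deterministic_controls \<or> D = randomized_controls"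
  shows "Q_mfc P r \<gamma> \<mu> h =
    (\<Sum>s\<in>UNIV. pmf \<mu> s * (\<Sum>a\<in>UNIV. Q_single P r \<gamma> D s a * pmf (h s) a))"
proof -
  note \<gamma> = assms(1,2)
  let ?J = "\<lambda>d s. expected_return P r \<gamma> (return_pmf s) d"
  obtain f where opt: "\<And>d s. ?J d s \<le> ?J (stationary f) s"
    by (rule ex_optimal_stationary[OF \<gamma>, of P r]) blast
  have "stationary f \<in> D"
    using assms(3)
    by (auto simp: deterministic_controls_def randomized_controls_def stationary_def[abs_def])
  then have "value_function P r \<gamma> D s = ?J (stationary f) s" for s
    unfolding value_function_def by (intro cSup_eq_maximum) (auto intro: opt)
  then have V: "value_function P r \<gamma> D = ?J (stationary f)" by blast
  let ?Q = "action_value P r \<gamma> (?J (stationary f))"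
  have rhs: "(\<Sum>s\<in>UNIV. pmf \<mu> s * (\<Sum>a\<in>UNIV. Q_single P r \<gamma> D s a * pmf (h s) a)) =
      measure_pmf.expectation (state_action_law \<mu> h) ?Q"
    by (simp add: expectation_state_action_law Q_single_def V action_value_def
        integral_measure_pmf[of UNIV] mult_ac)
  have ret: "expected_return P r \<gamma> \<mu> (mfc_control P \<mu> h \<pi>) =
      measure_pmf.expectation (state_action_law \<mu> h)
        (action_value P r \<gamma> (?J (\<lambda>t. mfc_control P \<mu> h \<pi> (Suc t))))" for \<pi>
    by (subst expected_return_step[OF \<gamma>]) (simp add: mfc_control_def)
  \<comment> \<open>Following \<open>f\<close> from time 1 on, whatever the law of the state, attains the supremum.\<close>
  let ?\<pi> = "\<lambda>t (s, \<nu> :: 's pmf). stationary f t s"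
  have "(\<lambda>t. mfc_control P \<mu> h ?\<pi> (Suc t)) = stationary f"
    by (auto simp: mfc_control_def stationary_def fun_eq_iff)
  then have "expected_return P r \<gamma> \<mu> (mfc_control P \<mu> h ?\<pi>) =
      measure_pmf.expectation (state_action_law \<mu> h) ?Q"
    by (simp add: ret)
  moreover have "?\<pi> \<in> mfc_policies"
  proof -
    have "(\<lambda>x. pmf (stationary f t (fst x)) a) \<in>
        borel_measurable (count_space UNIV \<Otimes>\<^sub>M (simplex_borel :: 's pmf measure))" for t a
      by (rule measurable_compose[OF measurable_fst]) simp
    then show ?thesis
      by (simp add: mfc_policies_def measurable_simplex_borel_iff case_prod_beta)
  qed
  ultimately have "Q_mfc P r \<gamma> \<mu> h = measure_pmf.expectation (state_action_law \<mu> h) ?Q"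
    unfolding Q_mfc_def
    by (intro cSup_eq_maximum)
       (force, auto simp: ret intro!: expectation_mono_finite action_value_mono \<gamma> opt)
  then show ?thesis using rhs by simp
qed

end
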